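(* Let $f:\mathbb{R}^n\to\mathbb{R}$ and $F:\mathbb{R}^n\to\mathbb{R}^m$ satisfy the local standing assumptions and the global assumptions listed in the context, and for $\varepsilon\ge0$ let $\mathcal{M}_\varepsilon=\{x\in\mathbb{R}^n:\|F(x)\|_2\le\varepsilon\}$. There exist constants $K_1,K_2>0$ and $\varepsilon_\star>0$ such that for any $0<\varepsilon\le\varepsilon_\star$ and any initialization $x_0\in\mathcal{M}_\varepsilon$, the SQP iterates $(x_i)_{i\ge0}$ with stepsize $\eta=\sqrt{\varepsilon/K_1}$ satisfy $\{x_i\}_{i\in\mathbb{N}}\subseteq\mathcal{M}_\varepsilon$; moreover, for any integer $k\ge1$, $$\min_{i\in\{1,\dots,k\}}\|\mathrm{grad} f(x_i)\|_2^2\le K_2\Big\{\frac{f(x_0)-\underline f}{k\sqrt{\varepsilon}}+\sqrt{\varepsilon}\Big\}.$$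
   Context: Setting. $m\le n$; $f:\mathbb{R}^n\to\mathbb{R}$ and $F:\mathbb{R}^n\to\mathbb{R}^m$ are $C^2$; $\mathcal{M}=\{x\in\mathbb{R}^n:F(x)=0\}$; $x_\star$ is a local minimizer of $f$ on $\mathcal{M}$. $\nabla f(x)\in\mathbb{R}^n$ is the gradient, $\nabla F(x)\in\mathbb{R}^{m\times n}$ the Jacobian, $A^\dagger$ the Moore–Penrose inverse (for $A\in\mathbb{R}^{m\times n}$ of rank $m$, $A^\dagger=A^{\mathsf T}(AA^{\mathsf T})^{-1}$), $A^{\dagger\mathsf T}$ its transpose, $B(x,r)$ the Euclidean ball, $\sigma_{\min}$ the least singular value. Matrices and tensors carry operator norms. All constants $\beta_f,\beta_F,\gamma_F,L_f,G_f$ are positive reals. Local standing assumptions, for some $\delta>0$: (1) On $B(x_\star,\delta)$, $f$ and $F$ are $C^2$ and Lipschitz with constants $L_f,L_F$, have Lipschitz gradients (Jacobians) with constants $\beta_f,\beta_F$, and Lipschitz Hessians with constants $\rho_f,\rho_F$. (2) $\mathcal{M}$ is an $(n-m)$-dimensional smooth submanifold of $\mathbb{R}^n$, and $\inf_{x\in B(x_\star,\delta)}\sigma_{\min}(\nabla F(x))\ge\gamma_F>0$. (3) With $\mathsf{P}_{x}=I_n-\nabla F(x)^\dagger\nabla F(x)$ and $\mathrm{Hess} f(x_\star)=\mathsf{P}_{x_\star}\nabla^2 f(x_\star)\mathsf{P}_{x_\star}-\sum_{i=1}^m[\nabla F(x_\star)^{\dagger\mathsf T}\nabla f(x_\star)]_i\,\mathsf{P}_{x_\star}\nabla^2F_i(x_\star)\mathsf{P}_{x_\star}$,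 the supremum $\lambda_{\max}$ and infimum $\lambda_{\min}$ of $\langle u,\mathrm{Hess} f(x_\star)u\rangle$ over $\|u\|_2=1$, $\nabla F(x_\star)u=0$, satisfy $0<\lambda_{\min}\le\lambda_{\max}<\infty$. Global assumptions: (i) There exists $\varepsilon_0>0$ such that $\sup_{x\in\mathcal{M}_{\varepsilon_0}}\|\nabla f(x)\|_2\le G_f$ and $\inf_{x\in\mathcal{M}_{\varepsilon_0}}f(x)\ge\underline f$, for some real $\underline f$. (ii) $\inf_{x\in\mathcal{M}_{\varepsilon_0}}\sigma_{\min}(\nabla F(x))\ge\gamma_F$. (iii) On all of $\mathbb{R}^n$: $f,F$ are $C^2$, $f$ is $L_f$-Lipschitz, and $\nabla f,\nabla F$ are Lipschitz with constants $\beta_f,\beta_F$. Extended Riemannian gradient: $\mathrm{grad} f(x)=\mathsf{P}_x\nabla f(x)$, for $x$ on or off $\mathcal{M}$. SQP iterates with stepsize $\eta>0$: $x_{k+1}$ is the minimizer of $f(x_k)+\langle\nabla f(x_k),x-x_k\rangle+\frac1{2\eta}\|x-x_k\|_2^2$ over $x$ subject to $F(x_k)+\nabla F(x_k)(x-x_k)=0$. When $\nabla F(x_k)$ has rank $m$ this is $x_{k+1}=x_k-\eta\,\mathrm{grad} f(x_k)-\nabla F(x_k)^\dagger F(x_k)$. *)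

theory Defs
  imports "HOL-Analysis.Analysis"
begin

section \<open>Derivatives\<close>

text \<open>
  First and second Frechet derivatives as bounded linear maps: the norms of the types
  \<open>'a \<Rightarrow>\<^sub>L 'b\<close> and \<open>'a \<Rightarrow>\<^sub>L 'a \<Rightarrow>\<^sub>L 'b\<close> are the operator norms (whereas the norm of the
  matrix type \<open>real ^ 'n ^ 'm\<close> is the Frobenius norm), so Lipschitz conditions on Jacobians
  and Hessians are stated with these.
\<close>

definition deriv1 ::
  "('a::real_normed_vector \<Rightarrow> 'b::real_normed_vector) \<Rightarrow> 'a \<Rightarrow> 'a \<Rightarrow>\<^sub>L 'b" where
  "deriv1 f x = Blinfun (frechet_derivative f (at x))"

definition deriv2 ::
  "('a::real_normed_vector \<Rightarrow> 'b::real_normed_vector) \<Rightarrow> 'a \<Rightarrow> 'a \<Rightarrow>\<^sub>L 'a \<Rightarrow>\<^sub>L 'b" where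
  "deriv2 f = deriv1 (deriv1 f)"

text \<open>Only used for open \<open>U\<close>.\<close>

definition C2_on ::
  "'a::real_normed_vector set \<Rightarrow> ('a \<Rightarrow> 'b::real_normed_vector) \<Rightarrow> bool" where
  "C2_on U f \<longleftrightarrow>
     (\<forall>x\<in>U. f differentiable (at x)) \<and>
     (\<forall>x\<in>U. deriv1 f differentiable (at x)) \<and>
     continuous_on U (deriv2 f)"

definition gradient :: "('a::real_inner \<Rightarrow> real) \<Rightarrow> 'a \<Rightarrow> 'a" where
  "gradient f x = (THE g. GDERIV f x :> g)"

definition jac :: "(real ^ 'n \<Rightarrow> real ^ 'm) \<Rightarrow> real ^ 'n \<Rightarrow> real ^ 'n ^ 'm" where
  "jac F x = jacobian F (at x)"

definition hessian :: "(real ^ 'n \<Rightarrow> real) \<Rightarrow> real ^ 'n \<Rightarrow> real ^ 'n ^ 'n" where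
  "hessian f x = jacobian (gradient f) (at x)"


section \<open>Singular values and the Moore--Penrose inverse\<close>

text \<open>
  With unit left and right singular vectors \<open>u\<close> and \<open>v\<close> both required, this is the set of the
  \<open>min m n\<close> singular values of an \<open>m \<times> n\<close> matrix; it contains \<open>0\<close> iff the rank
  is less than \<open>min m n\<close>. The set is finite and nonempty, so that \<^const>\<open>Inf\<close> below
  is its least element.
\<close>

definition singular_values :: "real ^ 'n ^ 'm \<Rightarrow> real set" where
  "singular_values A =
     {s. 0 \<le> s \<and> (\<exists>u v. norm u = 1 \<and> norm v = 1 \<and>
                    A *v v = s *\<^sub>R u \<and> transpose A *v u = s *\<^sub>R v)}"

definition sigma_min :: "real ^ 'n ^ 'm \<Rightarrow> real" where
  "sigma_min A = Inf (singular_values A)"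

definition pinv :: "real ^ 'n ^ 'm \<Rightarrow> real ^ 'm ^ 'n" where
  "pinv A = (THE X. A ** X ** A = A \<and> X ** A ** X = X \<and>
                    transpose (A ** X) = A ** X \<and> transpose (X ** A) = X ** A)"


section \<open>Constraint sets\<close>

definition feasible :: "(real ^ 'n \<Rightarrow> real ^ 'm) \<Rightarrow> (real ^ 'n) set" where
  "feasible F = {x. F x = 0}"

definition relaxed :: "(real ^ 'n \<Rightarrow> real ^ 'm) \<Rightarrow> real \<Rightarrow> (real ^ 'n) set" where
  "relaxed F \<epsilon> = {x. norm (F x) \<le> \<epsilon>}"

definition local_minimizer_on ::
  "'a::metric_space set \<Rightarrow> ('a \<Rightarrow> real) \<Rightarrow> 'a \<Rightarrow> bool" where
  "local_minimizer_on M f x \<longleftrightarrow> x \<in> M \<and> (\<exists>r>0. \<forall>y\<in>M \<inter> ball x r. f x \<le> f y)"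

text \<open>
  Embedded submanifold of dimension \<open>d\<close>, by slice charts. Smoothness is of class
  \<open>C\<^sup>2\<close>, the regularity of the functions considered; in particular every \<open>d\<close>-dimensional
  submanifold of class \<open>C\<^sup>\<infinity>\<close> satisfies this.
\<close>

definition embedded_submanifold :: "nat \<Rightarrow> 'a::euclidean_space set \<Rightarrow> bool" where
  "embedded_submanifold d M \<longleftrightarrow>
     (\<forall>p\<in>M. \<exists>U V \<phi> \<psi> S.
        open U \<and> p \<in> U \<and> open V \<and>
        homeomorphism U V \<phi> \<psi> \<and> C2_on U \<phi> \<and> C2_on V \<psi> \<and>
        subspace S \<and> dim S = d \<and> \<phi> ` (U \<inter> M) = V \<inter> (S :: 'a set))"


section \<open>Extended Riemannian gradient and Hessian\<close>

definition tangent_proj :: "(real ^ 'n \<Rightarrow> real ^ 'm) \<Rightarrow> real ^ 'n \<Rightarrow> real ^ 'n ^ 'n" where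
  "tangent_proj F x = mat 1 - pinv (jac F x) ** jac F x"

definition riem_grad ::
  "(real ^ 'n \<Rightarrow> real) \<Rightarrow> (real ^ 'n \<Rightarrow> real ^ 'm) \<Rightarrow> real ^ 'n \<Rightarrow> real ^ 'n" where
  "riem_grad f F x = tangent_proj F x *v gradient f x"

definition riem_hess ::
  "(real ^ 'n \<Rightarrow> real) \<Rightarrow> (real ^ 'n \<Rightarrow> real ^ 'm) \<Rightarrow> real ^ 'n \<Rightarrow> real ^ 'n ^ 'n" where
  "riem_hess f F x =
     (let P = tangent_proj F x;
          \<mu> = transpose (pinv (jac F x)) *v gradient f x
      in P ** hessian f x ** P
         - (\<Sum>i\<in>UNIV. \<mu> $ i *\<^sub>R (P ** hessian (\<lambda>y. F y $ i) x ** P)))"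

definition unit_tangent :: "(real ^ 'n \<Rightarrow> real ^ 'm) \<Rightarrow> real ^ 'n \<Rightarrow> (real ^ 'n) set" where
  "unit_tangent F x = {u. norm u = 1 \<and> jac F x *v u = 0}"

text \<open>
  Extended-real valued, so that for an empty set of unit tangent vectors the
  supremum is \<open>-\<infinity>\<close> and the infimum is \<open>\<infinity>\<close>.
\<close>

definition hess_lambda_max ::
  "(real ^ 'n \<Rightarrow> real) \<Rightarrow> (real ^ 'n \<Rightarrow> real ^ 'm) \<Rightarrow> real ^ 'n \<Rightarrow> ereal" where
  "hess_lambda_max f F x = (SUP u\<in>unit_tangent F x. ereal (u \<bullet> (riem_hess f F x *v u)))"

definition hess_lambda_min ::
  "(real ^ 'n \<Rightarrow> real) \<Rightarrow> (real ^ 'n \<Rightarrow> real ^ 'm) \<Rightarrow> real ^ 'n \<Rightarrow> ereal" where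
  "hess_lambda_min f F x = (INF u\<in>unit_tangent F x. ereal (u \<bullet> (riem_hess f F x *v u)))"


section \<open>SQP iterates\<close>

definition sqp_step ::
  "(real ^ 'n \<Rightarrow> real) \<Rightarrow> (real ^ 'n \<Rightarrow> real ^ 'm) \<Rightarrow> real \<Rightarrow> real ^ 'n \<Rightarrow> real ^ 'n \<Rightarrow> bool" where
  "sqp_step f F \<eta> x y \<longleftrightarrow>
     is_arg_min
       (\<lambda>z. f x + gradient f x \<bullet> (z - x) + 1 / (2 * \<eta>) * (norm (z - x))\<^sup>2)
       (\<lambda>z. F x + jac F x *v (z - x) = 0) y"

definition sqp_iterates ::
  "(real ^ 'n \<Rightarrow> real) \<Rightarrow> (real ^ 'n \<Rightarrow> real ^ 'm) \<Rightarrow> real \<Rightarrow> real ^ 'n \<Rightarrow> (nat \<Rightarrow> real ^ 'n) \<Rightarrow> bool"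
  where
  "sqp_iterates f F \<eta> x0 x \<longleftrightarrow> x 0 = x0 \<and> (\<forall>k. sqp_step f F \<eta> (x k) (x (Suc k)))"

end

theory Submission
  imports Defs
begin

text \<open>
  Write an SQP step as \<open>y = x - \<eta> g - p\<close> with \<open>g\<close> the
  extended Riemannian gradient and \<open>p = A\<^sup>\<dagger> F(x)\<close>, \<open>A\<close> the Jacobian. Since
  \<open>F(x) + A (y - x) = 0\<close>, \<open>\<parallel>F(y)\<parallel>\<close> is bounded by \<open>\<beta>_F \<parallel>y - x\<parallel>\<^sup>2\<close>, and
  \<open>\<parallel>y - x\<parallel>\<^sup>2 = \<eta>\<^sup>2 \<parallel>g\<parallel>\<^sup>2 + \<parallel>p\<parallel>\<^sup>2\<close> is at most \<open>\<eta>\<^sup>2 G_f\<^sup>2 + \<epsilon>\<^sup>2 / \<gamma>_F\<^sup>2\<close>;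
  the choice \<open>\<eta>\<^sup>2 = \<epsilon> / K1\<close> keeps the sum below \<open>\<epsilon> / \<beta>_F\<close>. The objective
  decreases by \<open>\<eta> \<parallel>g\<parallel>\<^sup>2 / 2\<close> up to an error \<open>O(\<epsilon>)\<close> coming from \<open>p\<close>, and summing over
  the steps \<open>1, \<dots>, k\<close> gives the rate.
\<close>

section \<open>Linear algebra\<close>

lemma inner_transpose_matrix_vector:
  fixes A :: "real ^ 'n ^ 'm"
  shows "(transpose A *v u) \<bullet> v = u \<bullet> (A *v v)"
  by (simp add: dot_lmul_matrix)

text \<open>If \<open>A\<close> were injective, \<open>m \<le> n\<close> would force full rank
  \<open>m = n\<close>, so \<open>A\<close> would be onto and \<open>u = A *v v\<close> would be
  orthogonal to itself. This supplies the right singular vector that \<open>singular_values\<close>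
  demands when the value is 0.\<close>

lemma exists_kernel_of_transpose_kernel:
  fixes A :: "real ^ 'n ^ 'm"
  assumes dims: "CARD('m) \<le> CARD('n)" and u: "transpose A *v u = 0" "u \<noteq> 0"
  obtains v where "norm v = 1" "A *v v = 0"
proof -
  have "\<not> inj ((*v) A)"
  proof
    assume "inj ((*v) A)"
    then have "rank A = CARD('n)"
      by (simp add: full_rank_injective)
    with rank_bound[of A] dims have "rank A = CARD('m)"
      by simp
    then have "surj ((*v) A)"
      by (simp add: full_rank_surjective)
    then obtain v where "u = A *v v"
      by blast
    then have "u \<bullet> u = (transpose A *v u) \<bullet> v"
      by (simp only: inner_transpose_matrix_vector)
    with u show False
      by simp
  qed
  then obtain w where w: "A *v w = 0" "w \<noteq> 0"
    using vec.inj_iff_eq_0 by metis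
  show thesis
    by (rule that[of "w /\<^sub>R norm w"])
      (use w in \<open>simp_all add: matrix_vector_mult_scaleR\<close>)
qed

text \<open>
  The least value of \<open>norm (transpose A *v u)\<close> over unit vectors \<open>u\<close> is a singular
  value: the first-order condition at a minimizer says that it is a left singular vector.
\<close>

lemma norm_transpose_ge_sigma_min:
  fixes A :: "real ^ 'n ^ 'm"
  assumes dims: "CARD('m) \<le> CARD('n)"
  shows "sigma_min A * norm u \<le> norm (transpose A *v u)"
proof -
  let ?N = "\<lambda>u. norm (transpose A *v u)"
  have "sphere (0 :: real ^ 'm) 1 \<noteq> {}"
    using vector_choose_size[of 1] by (metis dist_0_norm empty_iff mem_sphere zero_le_one)
  moreover have "continuous_on (sphere 0 1) ?N"
    by (intro continuous_intros linear_continuous_on matrix_vector_mul_bounded_linear)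
  ultimately obtain u0 where u0: "norm u0 = 1" and min0: "\<And>w. norm w = 1 \<Longrightarrow> ?N u0 \<le> ?N w"
    using continuous_attains_inf[OF compact_sphere[of 0 1], of ?N] by auto
  define s where "s = ?N u0"
  have s_nonneg: "0 \<le> s"
    by (simp add: s_def)
  have min: "s * norm w \<le> ?N w" for w
  proof (cases "w = 0")
    case False
    then have "s \<le> ?N (w /\<^sub>R norm w)"
      unfolding s_def by (intro min0) simp
    also have "\<dots> = ?N w / norm w"
      by (simp only: matrix_vector_mult_scaleR norm_scaleR) (simp add: divide_inverse_commute)
    finally show ?thesis
      using False by (simp add: field_simps)
  qed simp
  have "s \<in> singular_values A"
  proof (cases "s = 0")
    case True
    then have "transpose A *v u0 = 0"
      by (simp only: s_def norm_eq_zero)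
    moreover from this u0 obtain v where "norm v = 1" "A *v v = 0"
      using exists_kernel_of_transpose_kernel[OF dims, of A u0] by force
    ultimately show ?thesis
      using u0 True unfolding singular_values_def mem_Collect_eq
      by (metis order_refl scaleR_zero_left)
  next
    case False
    \<comment> \<open>Moving from \<open>u0\<close> to \<open>u0 + t *\<^sub>R w\<close> gives a
      nonnegative quadratic in \<open>t\<close> that vanishes at \<open>t = 0\<close>, so its linear
      coefficient is 0. As \<open>w\<close> is arbitrary, \<open>u0\<close> is an eigenvector of
      \<open>A ** transpose A\<close> for the eigenvalue \<open>s\<^sup>2\<close>.\<close>
    have crit: "(A *v (transpose A *v u0) - s\<^sup>2 *\<^sub>R u0) \<bullet> w = 0" for w
    proof -
      let ?b = "(A *v (transpose A *v u0) - s\<^sup>2 *\<^sub>R u0) \<bullet> w"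
      let ?c = "(?N w)\<^sup>2 - s\<^sup>2 * (norm w)\<^sup>2"
      have quad: "0 \<le> 2 * t * ?b + t\<^sup>2 * ?c" for t
      proof -
        have "(s * norm (u0 + t *\<^sub>R w))\<^sup>2 \<le> (?N (u0 + t *\<^sub>R w))\<^sup>2"
          by (intro power_mono min) (simp add: s_nonneg)
        moreover have "(norm (u0 + t *\<^sub>R w))\<^sup>2 = 1 + 2 * t * (u0 \<bullet> w) + t\<^sup>2 * (norm w)\<^sup>2"
          using u0 unfolding power2_norm_eq_inner inner_add_left inner_add_right norm_eq_1
          by (simp add: inner_commute power2_eq_square algebra_simps)
        moreover have "(?N (u0 + t *\<^sub>R w))\<^sup>2
            = s\<^sup>2 + 2 * t * ((transpose A *v u0) \<bullet> (transpose A *v w)) + t\<^sup>2 * (?N w)\<^sup>2"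
          unfolding s_def matrix_vector_right_distrib matrix_vector_mult_scaleR
            power2_norm_eq_inner inner_add_left inner_add_right inner_scaleR_left inner_scaleR_right
          by (simp add: inner_commute power2_eq_square algebra_simps)
        moreover have "(transpose A *v u0) \<bullet> (transpose A *v w) = (A *v (transpose A *v u0)) \<bullet> w"
          by (metis inner_commute inner_transpose_matrix_vector)
        ultimately show ?thesis
          by (simp add: power_mult_distrib inner_diff_left algebra_simps)
      qed
      show "?b = 0"
      proof (rule ccontr)
        assume "?b \<noteq> 0"
        \<comment> \<open>The minimizer of the quadratic after \<open>?c\<close> is replaced by the
          larger \<open>\<bar>?c\<bar> + 1\<close>, which is positive whatever the sign of
          \<open>?c\<close>.\<close>
        define t where "t = - ?b / (\<bar>?c\<bar> + 1)"
        have "2 * t * ?b + t\<^sup>2 * ?c \<le> 2 * t * ?b + t\<^sup>2 * (\<bar>?c\<bar> + 1)"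
          by (intro add_left_mono mult_left_mono) auto
        also have "\<dots> = - ?b\<^sup>2 / (\<bar>?c\<bar> + 1)"
        proof -
          define b d where "b = ?b" and "d = \<bar>?c\<bar> + 1"
          have "d > 0" by (simp add: d_def)
          then show ?thesis
            unfolding t_def b_def[symmetric] d_def[symmetric]
            by (simp add: field_simps power2_eq_square)
        qed
        also have "\<dots> < 0"
          using \<open>?b \<noteq> 0\<close> by (intro divide_neg_pos) auto
        finally show False
          using quad[of t] by simp
      qed
    qed
    then have "A *v (transpose A *v u0) - s\<^sup>2 *\<^sub>R u0 = 0"
      using inner_eq_zero_iff by blast
    then have eigen: "A *v (transpose A *v u0) = s\<^sup>2 *\<^sub>R u0"
      by simp
    define v where "v = (transpose A *v u0) /\<^sub>R s"
    have "norm v = 1"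
      using False s_nonneg unfolding v_def norm_scaleR s_def[symmetric] by simp
    moreover have "A *v v = s *\<^sub>R u0"
      unfolding v_def matrix_vector_mult_scaleR eigen
      using False by (simp add: power2_eq_square)
    moreover have "transpose A *v u0 = s *\<^sub>R v"
      unfolding v_def using False by simp
    ultimately show ?thesis
      unfolding singular_values_def mem_Collect_eq using u0 s_nonneg by blast
  qed
  moreover have "bdd_below (singular_values A)"
    by (rule bdd_belowI[of _ 0]) (simp add: singular_values_def)
  ultimately have "sigma_min A \<le> s"
    unfolding sigma_min_def by (rule cInf_lower)
  then have "sigma_min A * norm u \<le> s * norm u"
    by (rule mult_right_mono) simp
  with min[of u] show ?thesis
    by linarith
qed

section \<open>Moore-Penrose inverse and full row rank\<close>

lemma penrose_inverse_unique:
  fixes A :: "real ^ 'n ^ 'm" and X Y :: "real ^ 'm ^ 'n"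
  assumes X: "A ** X ** A = A" "X ** A ** X = X"
      "transpose (A ** X) = A ** X" "transpose (X ** A) = X ** A"
    and Y: "A ** Y ** A = A" "Y ** A ** Y = Y"
      "transpose (A ** Y) = A ** Y" "transpose (Y ** A) = Y ** A"
  shows "X = Y"
proof -
  \<comment> \<open>\<open>A ** X\<close> and \<open>A ** Y\<close> are symmetric and each absorbs
    the other on one side; transposing the product swaps the factors and identifies them. With the
    same for \<open>X ** A\<close>, one gets \<open>X = XAX = XAY = YAY = Y\<close>.\<close>
  have "A ** X = (A ** Y) ** (A ** X)"
    by (metis Y(1) matrix_mul_assoc)
  also have "\<dots> = transpose ((A ** X) ** (A ** Y))"
    by (simp only: matrix_transpose_mul[of "A ** X" "A ** Y"] X Y)
  also have "(A ** X) ** (A ** Y) = A ** Y"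
    by (metis X(1) matrix_mul_assoc)
  finally have AX: "A ** X = A ** Y"
    by (simp only: Y)
  have "X ** A = (X ** A) ** (Y ** A)"
    by (metis Y(1) matrix_mul_assoc)
  also have "\<dots> = transpose ((Y ** A) ** (X ** A))"
    by (simp only: matrix_transpose_mul[of "Y ** A" "X ** A"] X Y)
  also have "(Y ** A) ** (X ** A) = Y ** A"
    by (metis X(1) matrix_mul_assoc)
  finally have XA: "X ** A = Y ** A"
    by (simp only: Y)
  show ?thesis
    by (metis AX XA X(2) Y(2) matrix_mul_assoc)
qed

lemma pinv_eqI:
  fixes A :: "real ^ 'n ^ 'm"
  assumes "A ** X ** A = A" "X ** A ** X = X"
    "transpose (A ** X) = A ** X" "transpose (X ** A) = X ** A"
  shows "pinv A = X"
  unfolding pinv_def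
  by (rule the_equality) (use assms penrose_inverse_unique[of A] in \<open>blast+\<close>)

text \<open>The Gram matrix of the rows has trivial kernel, because its quadratic form is the
  squared norm of \<open>transpose A *v u\<close>, bounded below by \<open>sigma_min A\<close>. Its
  inverse \<open>R\<close> is symmetric, which yields the last Penrose equation.\<close>

lemma pinv_full_row_rank:
  fixes A :: "real ^ 'n ^ 'm"
  assumes dims: "CARD('m) \<le> CARD('n)" and sigma: "0 < sigma_min A"
  obtains R where "A ** transpose A ** R = mat 1" "pinv A = transpose A ** R"
proof -
  define S where "S = A ** transpose A"
  have S_sym: "transpose S = S"
    by (simp add: S_def matrix_transpose_mul)
  have "u = 0" if "S *v u = 0" for u
  proof -
    have "(transpose A *v u) \<bullet> (transpose A *v u) = u \<bullet> (S *v u)"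
      by (simp only: inner_transpose_matrix_vector S_def matrix_vector_mul_assoc)
    with that have "norm (transpose A *v u) = 0"
      by (simp only: inner_zero_right inner_eq_zero_iff norm_eq_zero)
    with norm_transpose_ge_sigma_min[OF dims, of A u] sigma show ?thesis
      by (simp add: mult_le_0_iff)
  qed
  then obtain R where RS: "R ** S = mat 1"
    using matrix_left_invertible_ker[of S] by blast
  then have SR: "S ** R = mat 1"
    by (simp add: matrix_left_right_inverse)
  have "transpose R ** S = transpose (S ** R)"
    by (simp only: matrix_transpose_mul S_sym)
  also have "\<dots> = mat 1"
    by (simp add: SR)
  finally have R_sym: "transpose R = R"
    by (metis SR matrix_mul_assoc matrix_mul_lid matrix_mul_rid)
  have AX: "A ** (transpose A ** R) = mat 1"
    using SR by (simp add: S_def matrix_mul_assoc)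
  have XA: "transpose ((transpose A ** R) ** A) = (transpose A ** R) ** A"
    by (simp add: matrix_transpose_mul R_sym matrix_mul_assoc)
  have "pinv A = transpose A ** R"
  proof (rule pinv_eqI)
    show "transpose A ** R ** A ** (transpose A ** R) = transpose A ** R"
      by (metis AX matrix_mul_assoc matrix_mul_rid)
  qed (simp_all only: AX XA matrix_mul_lid transpose_mat)
  with that SR show thesis
    by (simp add: S_def)
qed

lemma pinv_right_inverse:
  fixes A :: "real ^ 'n ^ 'm"
  assumes "CARD('m) \<le> CARD('n)" "0 < sigma_min A"
  shows "A *v (pinv A *v b) = b"
proof -
  obtain R where "A ** transpose A ** R = mat 1" "pinv A = transpose A ** R"
    using pinv_full_row_rank[OF assms] .
  then show ?thesis
    by (metis matrix_mul_assoc matrix_vector_mul_assoc matrix_vector_mul_lid)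
qed

text \<open>The range of \<open>pinv A\<close> lies in the row space of \<open>A\<close>, the
  orthogonal complement of the kernel.\<close>

lemma pinv_orthogonal_kernel:
  fixes A :: "real ^ 'n ^ 'm"
  assumes "CARD('m) \<le> CARD('n)" "0 < sigma_min A" and "A *v h = 0"
  shows "(pinv A *v b) \<bullet> h = 0"
proof -
  obtain R where "pinv A = transpose A ** R"
    using pinv_full_row_rank[OF assms(1,2)] .
  then have "pinv A *v b = transpose A *v (R *v b)"
    by (simp only: matrix_vector_mul_assoc)
  with assms(3) show ?thesis
    by (simp only: inner_transpose_matrix_vector inner_zero_right)
qed

text \<open>With \<open>p = transpose A *v w\<close> and \<open>A *v p = b\<close>, the square of
  \<open>norm p\<close> is \<open>w \<bullet> b\<close>, while
  \<open>c * norm w \<le> norm p\<close>; combining the two and cancelling one factor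
  \<open>norm p\<close> gives the bound.\<close>

lemma norm_pinv_le:
  fixes A :: "real ^ 'n ^ 'm"
  assumes dims: "CARD('m) \<le> CARD('n)" and c: "0 < c" "c \<le> sigma_min A"
  shows "norm (pinv A *v b) \<le> norm b / c"
proof -
  have sigma: "0 < sigma_min A"
    using c by linarith
  obtain R where "pinv A = transpose A ** R"
    using pinv_full_row_rank[OF dims sigma] .
  then have p: "pinv A *v b = transpose A *v (R *v b)"
    by (simp only: matrix_vector_mul_assoc)
  define p w where "p = pinv A *v b" and "w = R *v b"
  have "p \<bullet> p = w \<bullet> b"
    using pinv_right_inverse[OF dims sigma, of b] p inner_transpose_matrix_vector[of A w p]
    by (simp only: p_def w_def)
  then have p_sq: "(norm p)\<^sup>2 \<le> norm w * norm b"
    by (metis norm_cauchy_schwarz power2_norm_eq_inner)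
  have w_le: "c * norm w \<le> norm p"
    using norm_transpose_ge_sigma_min[OF dims, of A w] c(2) p
      mult_right_mono[OF c(2), of "norm w"] by (simp add: p_def w_def)
  have "c * (norm p)\<^sup>2 \<le> c * (norm w * norm b)"
    using c(1) p_sq by (intro mult_left_mono) simp_all
  also have "\<dots> \<le> norm p * norm b"
    using mult_right_mono[OF w_le, of "norm b"] by (simp add: mult.assoc)
  finally have "c * (norm p)\<^sup>2 \<le> norm p * norm b" .
  then have "c * norm p \<le> norm b"
    by (cases "p = 0") (simp_all add: power2_eq_square mult.left_commute)
  with c(1) show ?thesis
    by (simp add: p_def field_simps)
qed


section \<open>Derivatives\<close>

text \<open>The adjoint of the derivative at 1 is its representing vector; uniqueness of derivatives
  makes the \<open>THE\<close> in \<open>gradient\<close> denote it.\<close>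

lemma gradient_has_derivative:
  fixes f :: "'a::euclidean_space \<Rightarrow> real"
  assumes "f differentiable (at x)"
  shows "(f has_derivative (\<lambda>h. gradient f x \<bullet> h)) (at x)"
proof -
  obtain D where D: "(f has_derivative D) (at x)"
    using assms by (auto simp: differentiable_def)
  then have lin: "linear D"
    by (rule has_derivative_linear)
  define g where "g = adjoint D 1"
  have "D h = h \<bullet> g" for h
    using adjoint_works[OF lin, of h 1] by (simp add: g_def)
  then have "D = (\<lambda>h. h \<bullet> g)"
    by blast
  with D have g: "GDERIV f x :> g"
    by (simp add: gderiv_def)
  have "gradient f x = g"
    unfolding gradient_def
  proof (rule the_equality)
    show "GDERIV f x :> g"
      by (rule g)
  next
    fix g' assume "GDERIV f x :> g'"
    with g have "(\<lambda>h. h \<bullet> g') = (\<lambda>h. h \<bullet> g)"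
      unfolding gderiv_def by (rule has_derivative_unique[rotated])
    then show "g' = g"
      by (metis vector_eq_rdot inner_commute)
  qed
  with g show ?thesis
    by (simp add: gderiv_def inner_commute)
qed

lemma deriv1_has_derivative:
  assumes "f differentiable (at x)"
  shows "(f has_derivative blinfun_apply (deriv1 f x)) (at x)"
proof -
  have "(f has_derivative frechet_derivative f (at x)) (at x)"
    using assms by (simp add: frechet_derivative_works)
  then show ?thesis
    unfolding deriv1_def by (simp add: bounded_linear_Blinfun_apply has_derivative_bounded_linear)
qed

lemma jac_eq_deriv1:
  assumes "F differentiable (at x)"
  shows "jac F x *v h = deriv1 F x h"
  using has_derivative_unique[OF assms[unfolded jacobian_works] deriv1_has_derivative[OF assms]]
  by (metis jac_def)

section \<open>First-order Taylor remainders\<close>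

lemma linearization_error:
  fixes h :: "'a::real_normed_vector \<Rightarrow> 'b::real_normed_vector"
  assumes deriv: "\<And>x. (h has_derivative blinfun_apply (D x)) (at x)"
    and lip: "\<beta>-lipschitz_on UNIV D"
  shows "norm (h y - h x - D x (y - x)) \<le> \<beta> * (norm (y - x))\<^sup>2"
proof -
  \<comment> \<open>The mean value inequality uses the worst deviation of \<open>D\<close> from
    \<open>D x\<close> on the whole ball instead of integrating along the segment; hence the
    constant \<beta> rather than \<beta>/2.\<close>
  have "norm (h y - h x - D x (y - x)) \<le> norm (y - x) * (\<beta> * norm (y - x))"
  proof (rule differentiable_bound_linearization[where S = "cball x (norm (y - x))"])
    fix t :: real assume "t \<in> {0..1}"
    then show "x + t *\<^sub>R (y - x) \<in> cball x (norm (y - x))"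
      by (simp add: dist_norm mult_left_le_one_le)
  next
    fix z assume "z \<in> cball x (norm (y - x))"
    then have z: "norm (z - x) \<le> norm (y - x)"
      by (simp add: dist_norm norm_minus_commute)
    have "onorm (blinfun_apply (D z) - blinfun_apply (D x)) = norm (D z - D x)"
      by (simp add: norm_blinfun.rep_eq minus_blinfun.rep_eq fun_diff_def)
    also have "\<dots> \<le> \<beta> * norm (z - x)"
      using lipschitz_onD[OF lip, of z x] by (simp add: dist_norm)
    also have "\<dots> \<le> \<beta> * norm (y - x)"
      using z lipschitz_on_nonneg[OF lip] by (rule mult_left_mono)
    finally show "onorm (blinfun_apply (D z) - blinfun_apply (D x)) \<le> \<beta> * norm (y - x)" .
  qed (auto intro: has_derivative_at_withinI deriv)
  then show ?thesis
    by (simp add: power2_eq_square ac_simps)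
qed

text \<open>Identifying a vector with its inner-product functional does not increase norms, so the
  Lipschitz constant of the gradient passes to the derivative and \<open>linearization_error\<close>
  applies.\<close>

lemma gradient_linearization_error:
  fixes f :: "'a::euclidean_space \<Rightarrow> real"
  assumes "\<And>x. f differentiable (at x)" and lip: "\<beta>-lipschitz_on UNIV (gradient f)"
  shows "\<bar>f y - f x - gradient f x \<bullet> (y - x)\<bar> \<le> \<beta> * (norm (y - x))\<^sup>2"
proof -
  have "\<beta>-lipschitz_on UNIV (\<lambda>x. blinfun_inner_left (gradient f x))"
  proof (rule lipschitz_onI)
    fix x y
    have "norm (blinfun_inner_left (gradient f x) - blinfun_inner_left (gradient f y))
        \<le> norm (gradient f x - gradient f y)"
    proof (rule norm_blinfun_bound)
      fix h
      show "norm ((blinfun_inner_left (gradient f x) - blinfun_inner_left (gradient f y)) h)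
          \<le> norm (gradient f x - gradient f y) * norm h"
        using Cauchy_Schwarz_ineq2[of "gradient f x - gradient f y" h]
        by (simp add: blinfun.diff_left inner_diff_left inner_diff_right inner_commute)
    qed simp
    also have "\<dots> \<le> \<beta> * dist x y"
      using lipschitz_onD[OF lip, of x y] by (simp add: dist_norm)
    finally show "dist (blinfun_inner_left (gradient f x)) (blinfun_inner_left (gradient f y))
        \<le> \<beta> * dist x y"
      by (simp add: dist_norm)
  qed (rule lipschitz_on_nonneg[OF lip])
  from linearization_error[OF _ this, of f] gradient_has_derivative[OF assms(1)]
  show ?thesis
    by (simp add: inner_commute)
qed


section \<open>SQP steps\<close>

text \<open>All four facts express that \<open>tangent_proj F x\<close> is the orthogonal projection
  onto the kernel of the Jacobian.\<close>

lemma
  fixes f :: "real ^ 'n \<Rightarrow> real" and F :: "real ^ 'n \<Rightarrow> real ^ 'm"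
  assumes dims: "CARD('m) \<le> CARD('n)" and sigma: "0 < sigma_min (jac F x)"
  shows jac_riem_grad: "jac F x *v riem_grad f F x = 0"
    and inner_riem_grad_kernel:
      "jac F x *v h = 0 \<Longrightarrow> riem_grad f F x \<bullet> h = gradient f x \<bullet> h"
    and gradient_inner_riem_grad:
      "gradient f x \<bullet> riem_grad f F x = (norm (riem_grad f F x))\<^sup>2"
    and norm_riem_grad_le: "norm (riem_grad f F x) \<le> norm (gradient f x)"
proof -
  let ?A = "jac F x" and ?v = "gradient f x" and ?g = "riem_grad f F x"
  have g: "?g = ?v - pinv ?A *v (?A *v ?v)"
    by (simp add: riem_grad_def tangent_proj_def matrix_vector_mult_diff_rdistrib
        matrix_vector_mul_assoc)
  show 1: "?A *v ?g = 0"
    by (simp add: g matrix_vector_mult_diff_distrib pinv_right_inverse[OF dims sigma])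
  show 2: "?g \<bullet> h = ?v \<bullet> h" if "?A *v h = 0" for h
    by (simp add: g inner_diff_left pinv_orthogonal_kernel[OF dims sigma that])
  show 3: "?v \<bullet> ?g = (norm ?g)\<^sup>2"
    by (simp add: 2[OF 1, symmetric] power2_norm_eq_inner)
  then have "norm ?g * norm ?g \<le> norm ?v * norm ?g"
    by (metis norm_cauchy_schwarz power2_eq_square)
  then show "norm ?g \<le> norm ?v"
    by (cases "?g = 0") simp_all
qed

text \<open>The closed form of the SQP step under full row rank, as a total function so that the
  iterates can be written as powers of a map.\<close>

definition sqp_map ::
  "(real ^ 'n \<Rightarrow> real) \<Rightarrow> (real ^ 'n \<Rightarrow> real ^ 'm) \<Rightarrow> real \<Rightarrow> real ^ 'n \<Rightarrow> real ^ 'n" where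
  "sqp_map f F \<eta> x = x - \<eta> *\<^sub>R riem_grad f F x - pinv (jac F x) *v F x"

lemma sqp_map_feasible:
  fixes f :: "real ^ 'n \<Rightarrow> real" and F :: "real ^ 'n \<Rightarrow> real ^ 'm"
  assumes "CARD('m) \<le> CARD('n)" "0 < sigma_min (jac F x)"
  shows "F x + jac F x *v (sqp_map f F \<eta> x - x) = 0"
proof -
  have "sqp_map f F \<eta> x - x = - (\<eta> *\<^sub>R riem_grad f F x) - pinv (jac F x) *v F x"
    by (simp add: sqp_map_def)
  then show ?thesis
    using jac_riem_grad[OF assms] pinv_right_inverse[OF assms]
    by (simp add: matrix_vector_mult_diff_distrib matrix_vector_mult_scaleR
        flip: scaleR_minus_left)
qed

text \<open>On the affine feasible set the quadratic objective exceeds its value at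
  \<open>y0\<close> by exactly \<open>1 / (2 * \<eta>)\<close> times the squared distance to
  \<open>y0\<close>. Optimality and uniqueness both follow.\<close>

lemma sqp_step_iff:
  fixes f :: "real ^ 'n \<Rightarrow> real" and F :: "real ^ 'n \<Rightarrow> real ^ 'm"
  assumes dims: "CARD('m) \<le> CARD('n)" and sigma: "0 < sigma_min (jac F x)" and \<eta>: "0 < \<eta>"
  shows "sqp_step f F \<eta> x y \<longleftrightarrow> y = sqp_map f F \<eta> x"
proof -
  let ?A = "jac F x" and ?g = "riem_grad f F x"
  let ?obj = "\<lambda>z. f x + gradient f x \<bullet> (z - x) + 1 / (2 * \<eta>) * (norm (z - x))\<^sup>2"
  let ?feas = "\<lambda>z. F x + ?A *v (z - x) = 0"
  define y0 where "y0 = sqp_map f F \<eta> x"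
  have feas: "?feas y0"
    unfolding y0_def by (rule sqp_map_feasible[OF dims sigma])
  have obj: "?obj z = ?obj y0 + 1 / (2 * \<eta>) * (norm (z - y0))\<^sup>2" if z: "?feas z" for z
  proof -
    define h where "h = z - y0"
    have "?A *v h = ?A *v (z - x) - ?A *v (y0 - x)"
      by (simp add: h_def flip: matrix_vector_mult_diff_distrib)
    with z feas have h: "?A *v h = 0"
      by (metis add_left_cancel right_minus_eq)
    have zx: "z - x = (y0 - x) + h"
      by (simp add: h_def)
    have "y0 - x = - (\<eta> *\<^sub>R ?g) - pinv ?A *v F x"
      by (simp add: y0_def sqp_map_def)
    \<comment> \<open>Stationarity along the kernel: after division by \<eta>, the cross term of the
      squared norm cancels the change \<open>gradient f x \<bullet> h\<close> of the linear
      term.\<close>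
    then have d: "(y0 - x) \<bullet> h = - \<eta> * (gradient f x \<bullet> h)"
      by (simp add: inner_diff_left pinv_orthogonal_kernel[OF dims sigma h]
          inner_riem_grad_kernel[OF dims sigma h])
    have "(norm (z - x))\<^sup>2 = (norm (y0 - x))\<^sup>2 + 2 * ((y0 - x) \<bullet> h) + (norm h)\<^sup>2"
      unfolding zx by (simp add: power2_norm_eq_inner inner_add_left inner_add_right inner_commute)
    moreover have "gradient f x \<bullet> (z - x) = gradient f x \<bullet> (y0 - x) + gradient f x \<bullet> h"
      unfolding zx by (rule inner_add_right)
    ultimately show ?thesis
      using \<eta> by (simp add: d h_def[symmetric] field_simps)
  qed
  have pos: "0 < 1 / (2 * \<eta>)"
    using \<eta> by simp
  show ?thesis
    unfolding sqp_step_def y0_def[symmetric] is_arg_min_def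
  proof (intro iffI conjI notI)
    assume y: "?feas y \<and> \<not> (\<exists>z. ?feas z \<and> ?obj z < ?obj y)"
    with feas have "?obj y \<le> ?obj y0"
      using not_less by blast
    moreover have "?obj y = ?obj y0 + 1 / (2 * \<eta>) * (norm (y - y0))\<^sup>2"
      using y by (intro obj) blast
    ultimately have "1 / (2 * \<eta>) * (norm (y - y0))\<^sup>2 \<le> 0"
      by linarith
    with \<eta> show "y = y0"
      by (simp add: divide_le_0_iff)
  next
    assume "y = y0"
    with feas show "?feas y"
      by simp
  next
    assume "y = y0" "\<exists>z. ?feas z \<and> ?obj z < ?obj y"
    then obtain z where "?feas z" "?obj z < ?obj y0"
      by blast
    with obj[OF this(1)] have "1 / (2 * \<eta>) * (norm (z - y0))\<^sup>2 < 0"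
      by linarith
    moreover have "0 \<le> 1 / (2 * \<eta>) * (norm (z - y0))\<^sup>2"
      using pos by (intro mult_nonneg_nonneg) simp_all
    ultimately show False
      by linarith
  qed
qed

text \<open>Pythagoras: the gradient part lies in the kernel of the Jacobian and the correction
  \<open>pinv (jac F x) *v F x\<close> is orthogonal to it.\<close>

lemma norm_sqp_displacement:
  fixes f :: "real ^ 'n \<Rightarrow> real" and F :: "real ^ 'n \<Rightarrow> real ^ 'm"
  assumes dims: "CARD('m) \<le> CARD('n)" and sigma: "0 < sigma_min (jac F x)"
  shows "(norm (sqp_map f F \<eta> x - x))\<^sup>2
    = \<eta>\<^sup>2 * (norm (riem_grad f F x))\<^sup>2 + (norm (pinv (jac F x) *v F x))\<^sup>2"
proof -
  have "sqp_map f F \<eta> x - x = - (\<eta> *\<^sub>R riem_grad f F x + pinv (jac F x) *v F x)"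
    by (simp add: sqp_map_def)
  then show ?thesis
    using pinv_orthogonal_kernel[OF dims sigma jac_riem_grad[OF dims sigma], of "F x" f]
    unfolding power2_norm_eq_inner
    by (simp only: inner_minus_left inner_minus_right minus_minus)
      (simp add: inner_add_left inner_add_right inner_commute
        power2_eq_square algebra_simps)
qed

section \<open>Iterating a map on an invariant set, and averaging a descent inequality\<close>

lemma sqp_iterates_iff:
  assumes inv: "x0 \<in> M" "\<And>x. x \<in> M \<Longrightarrow> T x \<in> M"
    and step: "\<And>x y. x \<in> M \<Longrightarrow> sqp_step f F \<eta> x y \<longleftrightarrow> y = T x"
  shows "sqp_iterates f F \<eta> x0 x \<longleftrightarrow> x = (\<lambda>k. (T ^^ k) x0)"
proof -
  have mem: "(T ^^ k) x0 \<in> M" for k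
    by (induction k) (simp_all add: inv)
  show ?thesis
  proof
    assume x: "sqp_iterates f F \<eta> x0 x"
    have "x k = (T ^^ k) x0" for k
    proof (induction k)
      case 0
      from x show ?case by (simp add: sqp_iterates_def)
    next
      case (Suc k)
      from x have "sqp_step f F \<eta> (x k) (x (Suc k))"
        by (simp add: sqp_iterates_def)
      with Suc step[OF mem] show ?case by simp
    qed
    then show "x = (\<lambda>k. (T ^^ k) x0)"
      by blast
  next
    assume "x = (\<lambda>k. (T ^^ k) x0)"
    then show "sqp_iterates f F \<eta> x0 x"
      by (simp add: sqp_iterates_def step[OF mem])
  qed
qed

text \<open>The minimum is at most the average, and the sum of the descent inequalities
  telescopes.\<close>

lemma Min_le_average_of_descent:
  fixes a \<phi> :: "nat \<Rightarrow> real"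
  assumes c: "0 < c" and e: "0 \<le> e" and a: "\<And>i. 0 \<le> a i" and low: "\<And>i. l \<le> \<phi> i"
    and descent: "\<And>i. \<phi> (Suc i) \<le> \<phi> i - c * a i + e" and k: "1 \<le> k"
  shows "(MIN i\<in>{1..k}. a i) \<le> (\<phi> 0 - l) / (real k * c) + 2 * e / c"
proof -
  let ?m = "MIN i\<in>{1..k}. a i"
  have "real k * ?m = (\<Sum>i=1..k. ?m)"
    by simp
  also have "\<dots> \<le> (\<Sum>i=1..k. a i)"
    by (rule sum_mono) (simp add: Min_le)
  finally have "c * (real k * ?m) \<le> c * (\<Sum>i=1..k. a i)"
    using c by (intro mult_left_mono) simp_all
  also have "\<dots> = (\<Sum>i=1..k. c * a i)"
    by (simp add: sum_distrib_left)
  also have "\<dots> \<le> (\<Sum>i=1..k. (\<phi> i - \<phi> (Suc i)) + e)"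
  proof (rule sum_mono)
    fix i
    show "c * a i \<le> (\<phi> i - \<phi> (Suc i)) + e"
      using descent[of i] by linarith
  qed
  also have "\<dots> = (\<phi> 1 - \<phi> (Suc k)) + real k * e"
    using sum_Suc_diff[of 1 k "\<lambda>i. - \<phi> i"] k by (simp add: sum.distrib)
  \<comment> \<open>The sum starts at index 1, so one more descent step passes from
    \<open>\<phi> 1\<close> to \<open>\<phi> 0\<close>. Its error \<open>e\<close> is at most
    \<open>real k * e\<close> since \<open>k \<ge> 1\<close>, whence the factor 2.\<close>
  also have "\<dots> \<le> (\<phi> 0 - l) + 2 * (real k * e)"
  proof -
    have "0 \<le> c * a 0"
      using c a by simp
    moreover have "1 * e \<le> real k * e"
      using k e by (intro mult_right_mono) simp_all
    ultimately show ?thesis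
      using descent[of 0] low[of "Suc k"] unfolding One_nat_def by linarith
  qed
  finally show ?thesis
    using c k by (simp add: field_simps)
qed


section \<open>Global convergence\<close>

theorem theorem2:
  fixes f :: "real ^ 'n \<Rightarrow> real" and F :: "real ^ 'n \<Rightarrow> real ^ 'm"
    and x_star :: "real ^ 'n"
    and \<delta> \<epsilon>0 L_f L_F \<beta>_f \<beta>_F \<rho>_f \<rho>_F \<gamma>_F G_f f_low :: real
  assumes dims: "CARD('m) \<le> CARD('n)"
    and constants: "\<beta>_f > 0" "\<beta>_F > 0" "\<gamma>_F > 0" "L_f > 0" "G_f > 0"
    and x_star: "local_minimizer_on (feasible F) f x_star"
    and delta: "\<delta> > 0"
    and local_C2: "C2_on (ball x_star \<delta>) f" "C2_on (ball x_star \<delta>) F"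
    and local_lip: "L_f-lipschitz_on (ball x_star \<delta>) f" "L_F-lipschitz_on (ball x_star \<delta>) F"
    and local_grad_lip: "\<beta>_f-lipschitz_on (ball x_star \<delta>) (gradient f)"
      "\<beta>_F-lipschitz_on (ball x_star \<delta>) (deriv1 F)"
    and local_hess_lip: "\<rho>_f-lipschitz_on (ball x_star \<delta>) (deriv2 f)"
      "\<rho>_F-lipschitz_on (ball x_star \<delta>) (deriv2 F)"
    and manifold: "embedded_submanifold (CARD('n) - CARD('m)) (feasible F)"
    and local_sigma: "\<forall>x\<in>ball x_star \<delta>. \<gamma>_F \<le> sigma_min (jac F x)"
    and local_hess: "0 < hess_lambda_min f F x_star"
      "hess_lambda_min f F x_star \<le> hess_lambda_max f F x_star"
      "hess_lambda_max f F x_star < \<infinity>"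
    and eps0: "\<epsilon>0 > 0"
    and global_grad: "\<forall>x\<in>relaxed F \<epsilon>0. norm (gradient f x) \<le> G_f"
    and global_low: "\<forall>x\<in>relaxed F \<epsilon>0. f_low \<le> f x"
    and global_sigma: "\<forall>x\<in>relaxed F \<epsilon>0. \<gamma>_F \<le> sigma_min (jac F x)"
    and global_C2: "C2_on UNIV f" "C2_on UNIV F"
    and global_lip: "L_f-lipschitz_on UNIV f"
    and global_grad_lip: "\<beta>_f-lipschitz_on UNIV (gradient f)" "\<beta>_F-lipschitz_on UNIV (deriv1 F)"
  shows "\<exists>K1>0. \<exists>K2>0. \<exists>\<epsilon>_star>0. \<forall>\<epsilon>::real. 0 < \<epsilon> \<and> \<epsilon> \<le> \<epsilon>_star \<longrightarrow>
    (\<forall>x0\<in>relaxed F \<epsilon>.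
       (\<exists>!x. sqp_iterates f F (sqrt (\<epsilon> / K1)) x0 x) \<and>
       (\<forall>x. sqp_iterates f F (sqrt (\<epsilon> / K1)) x0 x \<longrightarrow>
          range x \<subseteq> relaxed F \<epsilon> \<and>
          (\<forall>k\<ge>1. (MIN i\<in>{1..k}. (norm (riem_grad f F (x i)))\<^sup>2)
             \<le> K2 * ((f x0 - f_low) / (real k * sqrt \<epsilon>) + sqrt \<epsilon>))))"
proof -
  have f_diff: "f differentiable (at x)" and F_diff: "F differentiable (at x)" for x
    using global_C2 by (simp_all add: C2_on_def)
  \<comment> \<open>Chosen so that
    \<open>\<beta>_F * \<eta>\<^sup>2 * G_f\<^sup>2 = \<epsilon> / 2\<close> when
    \<open>\<eta>\<^sup>2 = \<epsilon> / K1\<close>.\<close>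
  define K1 where "K1 = 2 * \<beta>_F * G_f\<^sup>2"
  \<comment> \<open>The coefficient of \<epsilon> in the descent error: the first summand comes from
    the gradient paired with the correction, the second from the quadratic remainder.\<close>
  define C where "C = G_f / \<gamma>_F + \<beta>_f / \<gamma>_F\<^sup>2"
  define K2 where "K2 = sqrt K1 * (2 + 4 * C)"
  \<comment> \<open>In order, the entries give access to the global bounds,
    \<open>\<epsilon>\<^sup>2 \<le> \<epsilon>\<close>, \<open>\<beta>_F * \<epsilon>\<^sup>2 /
    \<gamma>_F\<^sup>2 \<le> \<epsilon> / 2\<close>, and
    \<open>\<beta>_f * \<eta> \<le> 1 / 2\<close>.\<close>
  define \<epsilon>_star where
    "\<epsilon>_star = Min {\<epsilon>0, 1, \<gamma>_F\<^sup>2 / (2 * \<beta>_F), K1 / (4 * \<beta>_f\<^sup>2)}"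
  have K1: "0 < K1" and C: "0 < C"
    using constants by (simp_all add: K1_def C_def add_pos_pos)
  have K2: "0 < K2"
    using K1 C by (simp add: K2_def)
  have \<epsilon>_star: "0 < \<epsilon>_star"
    using eps0 constants K1 by (simp add: \<epsilon>_star_def)
  show ?thesis
  proof (rule exI[of _ K1], rule conjI[OF K1], rule exI[of _ K2], rule conjI[OF K2],
      rule exI[of _ \<epsilon>_star], rule conjI[OF \<epsilon>_star], intro allI impI ballI conjI)
    fix \<epsilon> :: real and x0
    assume "0 < \<epsilon> \<and> \<epsilon> \<le> \<epsilon>_star" and x0: "x0 \<in> relaxed F \<epsilon>"
    then have \<epsilon>: "0 < \<epsilon>" "\<epsilon> \<le> \<epsilon>0" "\<epsilon> \<le> 1" "\<epsilon> \<le> \<gamma>_F\<^sup>2 / (2 * \<beta>_F)" "\<epsilon> \<le> K1 / (4 * \<beta>_f\<^sup>2)"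
      by (simp_all add: \<epsilon>_star_def)
    define \<eta> where "\<eta> = sqrt (\<epsilon> / K1)"
    have \<eta>: "0 < \<eta>" and \<eta>2: "\<eta>\<^sup>2 = \<epsilon> / K1"
      using \<epsilon>(1) K1 by (simp_all add: \<eta>_def)
    have "\<eta>\<^sup>2 \<le> (1 / (2 * \<beta>_f))\<^sup>2"
      unfolding \<eta>2 using \<epsilon>(5) constants(1) K1 by (simp add: field_simps power2_eq_square)
    then have "\<eta> \<le> 1 / (2 * \<beta>_f)"
      using constants(1) by (intro power2_le_imp_le[of \<eta>]) simp_all
    then have \<beta>\<eta>: "\<beta>_f * \<eta> \<le> 1 / 2"
      using constants(1) by (simp add: field_simps)
    define T where "T = sqp_map f F \<eta>"
    let ?g = "riem_grad f F"
    have rel: "x \<in> relaxed F \<epsilon>0" if "x \<in> relaxed F \<epsilon>" for x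
      using that \<epsilon>(2) by (simp add: relaxed_def)
    have sigma: "\<gamma>_F \<le> sigma_min (jac F x)" "0 < sigma_min (jac F x)"
      if "x \<in> relaxed F \<epsilon>" for x
      using global_sigma rel[OF that] constants(3) by force+
    have step: "sqp_step f F \<eta> x y \<longleftrightarrow> y = T x" if "x \<in> relaxed F \<epsilon>" for x y
      unfolding T_def using sqp_step_iff[OF dims sigma(2)[OF that] \<eta>] .
    have p_le: "norm (pinv (jac F x) *v F x) \<le> \<epsilon> / \<gamma>_F" if x: "x \<in> relaxed F \<epsilon>" for x
    proof -
      have "norm (pinv (jac F x) *v F x) \<le> norm (F x) / \<gamma>_F"
        by (rule norm_pinv_le[OF dims constants(3) sigma(1)[OF x]])
      also have "\<dots> \<le> \<epsilon> / \<gamma>_F"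
        using x constants(3) by (simp add: relaxed_def divide_right_mono)
      finally show ?thesis .
    qed
    have d_le: "(norm (T x - x))\<^sup>2 \<le> \<eta>\<^sup>2 * (norm (?g x))\<^sup>2 + \<epsilon>\<^sup>2 / \<gamma>_F\<^sup>2" if x: "x \<in> relaxed F \<epsilon>" for x
      using power_mono[OF p_le[OF x], of 2]
      by (simp add: T_def norm_sqp_displacement[OF dims sigma(2)[OF x]] power_divide)
    have T_mem: "T x \<in> relaxed F \<epsilon>" if x: "x \<in> relaxed F \<epsilon>" for x
    proof -
      have "F x + deriv1 F x (T x - x) = 0"
        using sqp_map_feasible[OF dims sigma(2)[OF x], of f \<eta>] jac_eq_deriv1[OF F_diff]
        by (simp add: T_def)
      then have "norm (F (T x)) = norm (F (T x) - F x - deriv1 F x (T x - x))"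
        by (simp add: diff_diff_eq)
      also have "\<dots> \<le> \<beta>_F * (norm (T x - x))\<^sup>2"
        by (rule linearization_error[OF deriv1_has_derivative[OF F_diff] global_grad_lip(2)])
      also have "\<dots> \<le> \<beta>_F * (\<eta>\<^sup>2 * G_f\<^sup>2 + \<epsilon>\<^sup>2 / \<gamma>_F\<^sup>2)"
      proof -
        have "norm (?g x) \<le> G_f"
          using norm_riem_grad_le[OF dims sigma(2)[OF x], of f] global_grad rel[OF x] by force
        then have "\<eta>\<^sup>2 * (norm (?g x))\<^sup>2 \<le> \<eta>\<^sup>2 * G_f\<^sup>2"
          by (intro mult_left_mono power_mono) simp_all
        then show ?thesis
          using d_le[OF x] constants(2) by (intro mult_left_mono) simp_all
      qed
      \<comment> \<open>The tangential part takes exactly half of the budget \<epsilon> by the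
        choice of \<open>K1\<close>; the normal part takes at most the other half by the third entry
        of \<open>\<epsilon>_star\<close>.\<close>
      also have "\<dots> = \<epsilon> / 2 + \<epsilon> * (\<beta>_F * \<epsilon> / \<gamma>_F\<^sup>2)"
        unfolding \<eta>2 K1_def using constants by (simp add: field_simps power2_eq_square)
      also have "\<dots> \<le> \<epsilon> / 2 + \<epsilon> * (1 / 2)"
        using \<epsilon>(1,4) constants by (intro add_left_mono mult_left_mono) (simp_all add: field_simps)
      finally show ?thesis
        by (simp add: relaxed_def)
    qed
    have descent: "f (T x) \<le> f x - \<eta> / 2 * (norm (?g x))\<^sup>2 + C * \<epsilon>" if x: "x \<in> relaxed F \<epsilon>" for x
    proof -
      let ?p = "pinv (jac F x) *v F x" and ?G = "(norm (?g x))\<^sup>2"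
      have "T x - x = - (\<eta> *\<^sub>R ?g x) - ?p"
        by (simp add: T_def sqp_map_def)
      then have lin: "gradient f x \<bullet> (T x - x) = - \<eta> * ?G - gradient f x \<bullet> ?p"
        by (simp add: inner_diff_right gradient_inner_riem_grad[OF dims sigma(2)[OF x]])
      have "- (gradient f x \<bullet> ?p) \<le> norm (gradient f x) * norm ?p"
        using Cauchy_Schwarz_ineq2[of "gradient f x" ?p] by linarith
      also have "\<dots> \<le> G_f * (\<epsilon> / \<gamma>_F)"
        using global_grad rel[OF x] p_le[OF x] constants by (intro mult_mono) simp_all
      finally have grad_p: "- (gradient f x \<bullet> ?p) \<le> G_f / \<gamma>_F * \<epsilon>"
        by simp
      have "\<beta>_f * (norm (T x - x))\<^sup>2 \<le> \<beta>_f * (\<eta>\<^sup>2 * ?G + \<epsilon>\<^sup>2 / \<gamma>_F\<^sup>2)"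
        using d_le[OF x] constants(1) by (intro mult_left_mono) simp_all
      also have "\<dots> = (\<beta>_f * \<eta>) * (\<eta> * ?G) + \<beta>_f / \<gamma>_F\<^sup>2 * (\<epsilon> * \<epsilon>)"
        by (simp add: power2_eq_square algebra_simps)
      \<comment> \<open>The bound on \<open>\<beta>_f * \<eta>\<close> lets the quadratic remainder
        consume at most half of the linear decrease \<open>\<eta> * ?G\<close>.\<close>
      also have "\<dots> \<le> 1 / 2 * (\<eta> * ?G) + \<beta>_f / \<gamma>_F\<^sup>2 * (\<epsilon> * 1)"
        using \<beta>\<eta> \<eta> \<epsilon>(1,3) constants by (intro add_mono mult_left_mono mult_right_mono) simp_all
      finally have quad: "\<beta>_f * (norm (T x - x))\<^sup>2 \<le> \<eta> / 2 * ?G + \<beta>_f / \<gamma>_F\<^sup>2 * \<epsilon>"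
        by simp
      have "f (T x) \<le> f x + gradient f x \<bullet> (T x - x) + \<beta>_f * (norm (T x - x))\<^sup>2"
        using gradient_linearization_error[OF f_diff global_grad_lip(1), of "T x" x] by linarith
      also have "\<dots> \<le> f x - \<eta> / 2 * ?G + (G_f / \<gamma>_F * \<epsilon> + \<beta>_f / \<gamma>_F\<^sup>2 * \<epsilon>)"
        using quad grad_p by (simp add: lin)
      finally show ?thesis
        by (simp add: C_def algebra_simps)
    qed
    \<comment> \<open>Invariance of the relaxed set keeps the Jacobian of full row rank along the
      whole sequence, so each step is forced. Existence keeps the claim about all iterate sequences
      from being vacuous.\<close>
    have iff: "sqp_iterates f F \<eta> x0 x \<longleftrightarrow> x = (\<lambda>k. (T ^^ k) x0)" for x
      by (rule sqp_iterates_iff[OF x0 T_mem step])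
    show "\<exists>!x. sqp_iterates f F (sqrt (\<epsilon> / K1)) x0 x"
      unfolding \<eta>_def[symmetric] iff by blast
    fix x assume "sqp_iterates f F (sqrt (\<epsilon> / K1)) x0 x"
    then have x: "x = (\<lambda>k. (T ^^ k) x0)"
      unfolding \<eta>_def[symmetric] iff .
    have mem: "x k \<in> relaxed F \<epsilon>" for k
      unfolding x by (induction k) (simp_all add: x0 T_mem)
    then show "range x \<subseteq> relaxed F \<epsilon>"
      by blast
    fix k :: nat assume k: "1 \<le> k"
    have "(MIN i\<in>{1..k}. (norm (?g (x i)))\<^sup>2)
        \<le> (f (x 0) - f_low) / (real k * (\<eta> / 2)) + 2 * (C * \<epsilon>) / (\<eta> / 2)"
    proof (rule Min_le_average_of_descent[where \<phi> = "\<lambda>i. f (x i)", OF _ _ _ _ _ k])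
      show "f_low \<le> f (x i)" for i
        using global_low rel[OF mem] by blast
      show "f (x (Suc i)) \<le> f (x i) - \<eta> / 2 * (norm (?g (x i)))\<^sup>2 + C * \<epsilon>" for i
        using descent[OF mem[of i]] by (simp add: x)
    qed (use \<eta> C \<epsilon>(1) in simp_all)
    \<comment> \<open>Substituting \<open>\<eta> = sqrt \<epsilon> / sqrt K1\<close> turns both
      quotients by \<eta> into multiples of \<open>sqrt K1\<close>.\<close>
    also have "\<dots> = sqrt K1 * (2 * ((f x0 - f_low) / (real k * sqrt \<epsilon>)) + 4 * C * sqrt \<epsilon>)"
    proof -
      define s where "s = sqrt \<epsilon>"
      have s: "0 < s" "\<epsilon> = s * s"
        using \<epsilon>(1) by (simp_all add: s_def)
      have \<eta>_eq: "\<eta> = s / sqrt K1"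
        by (simp add: \<eta>_def s_def real_sqrt_divide)
      show ?thesis
        unfolding s_def[symmetric] x \<eta>_eq s(2) using s(1) K1 k by (simp add: field_simps)
    qed
    \<comment> \<open>Replacing the coefficients 2 and \<open>4 * C\<close> by their sum needs both
      terms to be nonnegative; for the first this is \<open>f_low \<le> f x0\<close>.\<close>
    also have "\<dots> \<le> sqrt K1 * ((2 + 4 * C) * ((f x0 - f_low) / (real k * sqrt \<epsilon>) + sqrt \<epsilon>))"
    proof -
      define q where "q = (f x0 - f_low) / (real k * sqrt \<epsilon>)"
      have "0 \<le> q"
        unfolding q_def using global_low rel[OF x0] \<epsilon>(1) by (intro divide_nonneg_nonneg) simp_all
      then have "0 \<le> 4 * C * q + 2 * sqrt \<epsilon>"
        using C \<epsilon>(1) by (intro add_nonneg_nonneg mult_nonneg_nonneg) simp_all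
      then show ?thesis
        unfolding q_def[symmetric] using K1
        by (intro mult_left_mono) (simp_all add: algebra_simps)
    qed
    finally show "(MIN i\<in>{1..k}. (norm (?g (x i)))\<^sup>2)
        \<le> K2 * ((f x0 - f_low) / (real k * sqrt \<epsilon>) + sqrt \<epsilon>)"
      by (simp add: K2_def mult.assoc)
  qed
qed

end
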